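(* Let $E$ be a Banach space, let $\mathcal{A}=(A_n)_{n\in\mathbb{N}}$ be a sequence of bounded linear operators on $E$ (not necessarily invertible), and let $\alpha\in\mathcal{E}_{ad}(\mathcal{A})$. Then the operator $G_\alpha$ is invertible on $c_{00}(\alpha)$ if and only if there exists $\beta<0$, $\beta\in\mathcal{E}_{ad}(\mathcal{A})$, such that $c_{00}(\alpha)=c_{00}(\beta)$ (equality as sets of sequences).
   Context: $\mathbb{N}=\{0,1,2,\ldots\}$, $\Delta=\{(m,n)\in\mathbb{N}\times\mathbb{N}: m\geq n\}$. For $(m,n)\in\Delta$ put $A(m,n)=A_{m-1}\cdots A_n$ if $m>n$ and $A(n,n)=\mathrm{Id}$. A real number $\alpha$ is an admissible exponent for $\mathcal{A}$ if there is a (not necessarily bounded) positive real sequence $(M_n)_{n\in\mathbb{N}}$ with $\|A(m,n)\|\leq M_n e^{\alpha(m-n)}$ for all $(m,n)\in\Delta$. $\mathcal{E}_{ad}(\mathcal{A})$ is the set of all admissible exponents of $\mathcal{A}$. For $\alpha\in\mathcal{E}_{ad}(\mathcal{A})$ and $n\in\mathbb{N}$, $\|x\|_{n,\alpha}=\sup_{m\geq n}e^{-\alpha(m-n)}\|A(m,n)x\|$, $x\in E$; this is a norm on $E$ with $\|x\|\leq\|x\|_{n,\alpha}\leq M_n\|x\|$. The space $c_{00}(\alpha)$ is the set of sequences $u=(u_n)_{n\in\mathbb{N}}$ in $E$ with $u_0=0$ and $\lim_{n\to\infty}\|u_n\|_{n,\alpha}=0$; it is a Banach space with norm $\|u\|_\alpha=\sup_{n\in\mathbb{N}}\|u_n\|_{n,\alpha}$.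 The evolution map $T$ acts on $E$-valued sequences by $(Tu)_0=0$ and $(Tu)_n=A_{n-1}u_{n-1}$ for $n\geq1$. $T_\alpha$ is its restriction to $c_{00}(\alpha)$, which is a bounded linear operator $c_{00}(\alpha)\to c_{00}(\alpha)$, and $G_\alpha=T_\alpha-\mathrm{Id}$ on $c_{00}(\alpha)$. *)

theory Defs
  imports "HOL-Analysis.Analysis"
begin

text \<open>
  The sequence \<open>A\<close> of bounded operators lives in the library type of bounded linear maps, so
  \<open>norm\<close> is the operator norm. \<open>evolution A m n\<close> is \<open>A(m,n) = A\<^sub>m\<^sub>-\<^sub>1 \<cdots> A\<^sub>n\<close> for \<open>m > n\<close> and the
  identity for \<open>m = n\<close>; its value (the identity) for \<open>m < n\<close> is never used.
\<close>

primrec evolution ::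
  "(nat \<Rightarrow> 'a::real_normed_vector \<Rightarrow>\<^sub>L 'a) \<Rightarrow> nat \<Rightarrow> nat \<Rightarrow> 'a \<Rightarrow>\<^sub>L 'a"
where
  "evolution A 0 n = id_blinfun"
| "evolution A (Suc m) n = (if n \<le> m then A m o\<^sub>L evolution A m n else id_blinfun)"

definition admissible_exponents :: "(nat \<Rightarrow> 'a::real_normed_vector \<Rightarrow>\<^sub>L 'a) \<Rightarrow> real set"
where
  "admissible_exponents A =
     {\<alpha>. \<exists>M :: nat \<Rightarrow> real. (\<forall>n. M n > 0) \<and>
        (\<forall>m n. n \<le> m \<longrightarrow> norm (evolution A m n) \<le> M n * exp (\<alpha> * (real m - real n)))}"

text \<open>
  The supremum below is taken in the reals; it is over a bounded set, hence meaningful, whenever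
  \<open>\<alpha>\<close> is an admissible exponent. The same applies to \<open>c00_norm\<close> for \<open>u\<close> in \<open>c00 A \<alpha>\<close>.
\<close>

definition adapted_norm ::
  "(nat \<Rightarrow> 'a::real_normed_vector \<Rightarrow>\<^sub>L 'a) \<Rightarrow> real \<Rightarrow> nat \<Rightarrow> 'a \<Rightarrow> real"
where
  "adapted_norm A \<alpha> n x =
     (SUP m\<in>{n..}. exp (- \<alpha> * (real m - real n)) * norm (blinfun_apply (evolution A m n) x))"

definition c00 ::
  "(nat \<Rightarrow> 'a::real_normed_vector \<Rightarrow>\<^sub>L 'a) \<Rightarrow> real \<Rightarrow> (nat \<Rightarrow> 'a) set"
where
  "c00 A \<alpha> = {u. u 0 = 0 \<and> (\<lambda>n. adapted_norm A \<alpha> n (u n)) \<longlonglongrightarrow> 0}"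

definition c00_norm ::
  "(nat \<Rightarrow> 'a::real_normed_vector \<Rightarrow>\<^sub>L 'a) \<Rightarrow> real \<Rightarrow> (nat \<Rightarrow> 'a) \<Rightarrow> real"
where
  "c00_norm A \<alpha> u = (SUP n. adapted_norm A \<alpha> n (u n))"

definition evolution_map ::
  "(nat \<Rightarrow> 'a::real_normed_vector \<Rightarrow>\<^sub>L 'a) \<Rightarrow> (nat \<Rightarrow> 'a) \<Rightarrow> (nat \<Rightarrow> 'a)"
where
  "evolution_map A u = (\<lambda>n. if n = 0 then 0 else blinfun_apply (A (n - 1)) (u (n - 1)))"

text \<open>
  The spaces \<open>c00 A \<alpha>\<close> depend on the variables \<open>A\<close> and \<open>\<alpha>\<close>, so they are not types. An operator on
  a space of sequences with carrier \<open>V\<close> and norm \<open>N\<close> is a total function on sequences of which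
  only the restriction to \<open>V\<close> matters; the vector space operations are pointwise.
\<close>

definition bounded_linear_operator_on ::
  "(nat \<Rightarrow> 'a::real_normed_vector) set \<Rightarrow> ((nat \<Rightarrow> 'a) \<Rightarrow> real) \<Rightarrow>
     ((nat \<Rightarrow> 'a) \<Rightarrow> (nat \<Rightarrow> 'a)) \<Rightarrow> bool"
where
  "bounded_linear_operator_on V N S \<longleftrightarrow>
     S ` V \<subseteq> V \<and>
     (\<forall>u\<in>V. \<forall>v\<in>V. S (\<lambda>n. u n + v n) = (\<lambda>n. S u n + S v n)) \<and>
     (\<forall>c. \<forall>u\<in>V. S (\<lambda>n. c *\<^sub>R u n) = (\<lambda>n. c *\<^sub>R S u n)) \<and>
     (\<exists>K. \<forall>u\<in>V. N (S u) \<le> K * N u)"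

text \<open>Invertibility is meant among bounded operators: the inverse is itself bounded and linear.\<close>

definition invertible_operator_on ::
  "(nat \<Rightarrow> 'a::real_normed_vector) set \<Rightarrow> ((nat \<Rightarrow> 'a) \<Rightarrow> real) \<Rightarrow>
     ((nat \<Rightarrow> 'a) \<Rightarrow> (nat \<Rightarrow> 'a)) \<Rightarrow> bool"
where
  "invertible_operator_on V N G \<longleftrightarrow>
     bounded_linear_operator_on V N G \<and>
     (\<exists>S. bounded_linear_operator_on V N S \<and> (\<forall>u\<in>V. S (G u) = u \<and> G (S u) = u))"

text \<open>\<open>T - Id\<close> on all sequences; \<open>G\<^sub>\<alpha>\<close> is its restriction to the carrier \<open>c00 A \<alpha>\<close>.\<close>

definition G_map ::
  "(nat \<Rightarrow> 'a::real_normed_vector \<Rightarrow>\<^sub>L 'a) \<Rightarrow> (nat \<Rightarrow> 'a) \<Rightarrow> (nat \<Rightarrow> 'a)"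
where
  "G_map A u = (\<lambda>n. evolution_map A u n - u n)"

end

theory Submission
  imports Defs
begin

text \<open>
  Solving \<open>G u = f\<close> amounts to the recursion \<open>u\<^sub>n\<^sub>+\<^sub>1 = A\<^sub>n u\<^sub>n - f\<^sub>n\<^sub>+\<^sub>1\<close>, and in the adapted norms
  \<open>A\<^sub>n\<close> has norm at most \<open>exp \<beta>\<close>; for \<open>\<beta> < 0\<close> this is a contraction, so \<open>G\<close> is invertible on
  \<open>c00 A \<beta>\<close>. Equality of the sets \<open>c00 A \<alpha>\<close> and \<open>c00 A \<beta>\<close> forces the adapted norms to be
  equivalent uniformly in \<open>n\<close>, so invertibility passes to \<open>c00 A \<alpha>\<close>.

  Conversely, if \<open>G\<close> has an inverse of norm at most \<open>K\<close>, let \<open>q = 1 + 1/(2K)\<close> and test it on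
  \<open>u\<^sub>n = q\<^bsup>min n m - k\<^esup> A(n,k) x\<close> for \<open>n \<ge> k\<close>, zero before \<open>k\<close>. Then \<open>G u\<close> is \<open>-x\<close> at \<open>k\<close>, is \<open>-(1 - 1/q) u\<^sub>n\<close> for
  \<open>k < n \<le> m\<close>, and vanishes elsewhere; as \<open>K (1 - 1/q) \<le> 1/2\<close>, the bound on the inverse can be
  absorbed and gives \<open>q\<^bsup>m-k\<^esup> \<parallel>A(m,k) x\<parallel> \<le> 2 K \<parallel>x\<parallel>\<close> in the adapted norms.
\<close>

section \<open>The evolution family and its cocycle identity\<close>

lemma evolution_self [simp]: "evolution A n n = id_blinfun"
  by (cases n) auto

lemma evolution_Suc_apply:
  "n \<le> m \<Longrightarrow> evolution A (Suc m) n x = A m (evolution A m n x)"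
  by simp

lemma evolution_compose:
  assumes "k \<le> n" "n \<le> m"
  shows "evolution A m n (evolution A n k x) = evolution A m k x"
  using assms(2,1)
  by (induction m rule: dec_induct) (auto simp del: evolution.simps simp: evolution_Suc_apply)

declare evolution.simps [simp del]

section \<open>Adapted norms and the space \<open>c00\<close> for one admissible exponent\<close>

context
  fixes A :: "nat \<Rightarrow> 'a::real_normed_vector \<Rightarrow>\<^sub>L 'a" and \<alpha> :: real
  assumes admissible: "\<alpha> \<in> admissible_exponents A"
begin

text \<open>Ensures that the supremum in \<open>adapted_norm\<close> is taken over a bounded set, so
  that it is a genuine least upper bound, and gives the comparison with the original norm.\<close>

lemma weighted_norm_bounded:
  "\<exists>M>0. \<forall>m\<ge>n. \<forall>x. exp (- \<alpha> * (real m - real n)) * norm (evolution A m n x) \<le> M * norm x"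
proof -
  obtain M where M: "\<And>n. M n > 0"
    "\<And>m n. n \<le> m \<Longrightarrow> norm (evolution A m n) \<le> M n * exp (\<alpha> * (real m - real n))"
    using admissible unfolding admissible_exponents_def by blast
  have "exp (- \<alpha> * (real m - real n)) * norm (evolution A m n x) \<le> M n * norm x"
    if "n \<le> m" for m x
  proof -
    define d where "d = real m - real n"
    have "norm (evolution A m n x) \<le> norm (evolution A m n) * norm x"
      by (rule norm_blinfun)
    also have "\<dots> \<le> M n * exp (\<alpha> * d) * norm x"
      unfolding d_def by (intro mult_right_mono M(2) that) auto
    finally show ?thesis by (simp add: exp_minus field_simps flip: d_def)
  qed
  then show ?thesis using M(1) by blast
qed

lemma adapted_norm_upper:
  assumes "n \<le> m"
  shows "exp (- \<alpha> * (real m - real n)) * norm (evolution A m n x) \<le> adapted_norm A \<alpha> n x"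
proof -
  obtain M where "\<forall>m\<ge>n. \<forall>x. exp (- \<alpha> * (real m - real n)) * norm (evolution A m n x) \<le> M * norm x"
    using weighted_norm_bounded by blast
  then have "bdd_above ((\<lambda>m. exp (- \<alpha> * (real m - real n)) * norm (evolution A m n x)) ` {n..})"
    by (intro bdd_aboveI2[where M = "M * norm x"]) auto
  then show ?thesis
    unfolding adapted_norm_def using assms by (intro cSUP_upper) auto
qed

lemma adapted_norm_least:
  assumes "\<And>m. n \<le> m \<Longrightarrow> exp (- \<alpha> * (real m - real n)) * norm (evolution A m n x) \<le> B"
  shows "adapted_norm A \<alpha> n x \<le> B"
  unfolding adapted_norm_def using assms by (intro cSUP_least) auto

lemma norm_le_adapted_norm: "norm x \<le> adapted_norm A \<alpha> n x"
  using adapted_norm_upper[of n n x] by simp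

lemma adapted_norm_nonneg [simp]: "0 \<le> adapted_norm A \<alpha> n x"
  using norm_le_adapted_norm norm_ge_zero order_trans by blast

lemma adapted_norm_le_norm: "\<exists>M>0. \<forall>x. adapted_norm A \<alpha> n x \<le> M * norm x"
  using weighted_norm_bounded[of n] adapted_norm_least by meson

lemma adapted_norm_zero [simp]: "adapted_norm A \<alpha> n 0 = 0"
  using adapted_norm_least[of n 0 0] adapted_norm_nonneg[of n 0] by (simp add: blinfun.zero_right)

lemma adapted_norm_add:
  "adapted_norm A \<alpha> n (x + y) \<le> adapted_norm A \<alpha> n x + adapted_norm A \<alpha> n y"
proof (rule adapted_norm_least)
  fix m assume "n \<le> m"
  have "exp (- \<alpha> * (real m - real n)) * norm (evolution A m n (x + y)) \<le>
    exp (- \<alpha> * (real m - real n)) * norm (evolution A m n x) +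
    exp (- \<alpha> * (real m - real n)) * norm (evolution A m n y)"
    unfolding distrib_left[symmetric] blinfun.add_right
    by (intro mult_left_mono norm_triangle_ineq) auto
  also have "\<dots> \<le> adapted_norm A \<alpha> n x + adapted_norm A \<alpha> n y"
    by (intro add_mono adapted_norm_upper \<open>n \<le> m\<close>)
  finally show "exp (- \<alpha> * (real m - real n)) * norm (evolution A m n (x + y)) \<le>
    adapted_norm A \<alpha> n x + adapted_norm A \<alpha> n y" .
qed

lemma adapted_norm_scaleR: "adapted_norm A \<alpha> n (c *\<^sub>R x) = \<bar>c\<bar> * adapted_norm A \<alpha> n x"
proof -
  have le: "adapted_norm A \<alpha> n (c *\<^sub>R x) \<le> \<bar>c\<bar> * adapted_norm A \<alpha> n x" for c x
  proof (rule adapted_norm_least)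
    fix m assume "n \<le> m"
    then show "exp (- \<alpha> * (real m - real n)) * norm (evolution A m n (c *\<^sub>R x)) \<le>
        \<bar>c\<bar> * adapted_norm A \<alpha> n x"
      using mult_left_mono[OF adapted_norm_upper[of n m x], of "\<bar>c\<bar>"]
      by (simp add: blinfun.scaleR_right mult_ac)
  qed
  show ?thesis
  proof (cases "c = 0")
    case False
    \<comment> \<open>The reverse inequality is \<open>le\<close> itself, applied to
      \<open>inverse c\<close> and the vector \<open>c *\<^sub>R x\<close>.\<close>
    have "\<bar>c\<bar> * adapted_norm A \<alpha> n x \<le> \<bar>c\<bar> * (\<bar>inverse c\<bar> * adapted_norm A \<alpha> n (c *\<^sub>R x))"
      using le[of "inverse c" "c *\<^sub>R x"] False by (intro mult_left_mono) auto
    then show ?thesis using le[of c x] False by (simp add: field_simps)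
  qed simp
qed

lemma adapted_norm_minus [simp]: "adapted_norm A \<alpha> n (- x) = adapted_norm A \<alpha> n x"
  using adapted_norm_scaleR[of n "-1" x] by simp

lemma adapted_norm_diff:
  "adapted_norm A \<alpha> n (x - y) \<le> adapted_norm A \<alpha> n x + adapted_norm A \<alpha> n y"
  using adapted_norm_add[of n x "- y"] by simp

text \<open>The orbit of \<open>A n x\<close> from time \<open>Suc n\<close> is the tail of the
  orbit of \<open>x\<close> from time \<open>n\<close>; measuring the elapsed time from
  \<open>Suc n\<close> instead of \<open>n\<close> costs the factor
  \<open>exp \<alpha>\<close>.\<close>

lemma adapted_norm_step: "adapted_norm A \<alpha> (Suc n) (A n x) \<le> exp \<alpha> * adapted_norm A \<alpha> n x"
proof (rule adapted_norm_least)
  fix m assume m: "Suc n \<le> m"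
  have "A n x = evolution A (Suc n) n x" by (simp add: evolution_Suc_apply)
  then have "evolution A m (Suc n) (A n x) = evolution A m n x"
    using evolution_compose[of n "Suc n" m A x] m by simp
  moreover have "exp (- \<alpha> * (real m - real (Suc n))) = exp \<alpha> * exp (- \<alpha> * (real m - real n))"
    by (simp add: algebra_simps flip: exp_add)
  ultimately show "exp (- \<alpha> * (real m - real (Suc n))) * norm (evolution A m (Suc n) (A n x))
      \<le> exp \<alpha> * adapted_norm A \<alpha> n x"
    using adapted_norm_upper[of n m x] m by simp
qed

lemma c00_norm_upper:
  assumes "u \<in> c00 A \<alpha>" shows "adapted_norm A \<alpha> n (u n) \<le> c00_norm A \<alpha> u"
proof -
  have "(\<lambda>n. adapted_norm A \<alpha> n (u n)) \<longlonglongrightarrow> 0"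
    using assms by (simp add: c00_def)
  then have "bdd_above (range (\<lambda>n. adapted_norm A \<alpha> n (u n)))"
    by (rule Bseq_bdd_above[OF convergent_imp_Bseq[OF convergentI]])
  then show ?thesis unfolding c00_norm_def by (intro cSUP_upper) auto
qed

lemma c00_norm_nonneg: "u \<in> c00 A \<alpha> \<Longrightarrow> 0 \<le> c00_norm A \<alpha> u"
  using c00_norm_upper adapted_norm_nonneg order_trans by blast

lemma finite_support_in_c00:
  assumes "u 0 = 0" "\<And>n. n > m \<Longrightarrow> u n = 0"
  shows "u \<in> c00 A \<alpha>"
proof -
  have "eventually (\<lambda>n. adapted_norm A \<alpha> n (u n) = 0) sequentially"
    using eventually_gt_at_top[of m] by eventually_elim (simp add: assms(2) admissible)
  then show ?thesis using assms(1) by (simp add: c00_def tendsto_eventually)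
qed

end

section \<open>Comparison of norms and spaces for two exponents\<close>

lemma c00_norm_least: "(\<And>n. adapted_norm A \<alpha> n (u n) \<le> B) \<Longrightarrow> c00_norm A \<alpha> u \<le> B"
  unfolding c00_norm_def by (intro cSUP_least) auto

text \<open>The comparison is asked only from time 1 on because the decay estimate it will be fed
  with starts there; a limit ignores the first term.\<close>

lemma c00_mono:
  assumes "\<beta> \<in> admissible_exponents A"
    and "\<And>n x. 1 \<le> n \<Longrightarrow> adapted_norm A \<beta> n x \<le> C * adapted_norm A \<alpha> n x"
  shows "c00 A \<alpha> \<subseteq> c00 A \<beta>"
proof
  fix u assume u: "u \<in> c00 A \<alpha>"
  have "(\<lambda>n. adapted_norm A \<beta> n (u n)) \<longlonglongrightarrow> 0"
  proof (rule tendsto_sandwich[OF _ _ tendsto_const])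
    show "(\<lambda>n. C * adapted_norm A \<alpha> n (u n)) \<longlonglongrightarrow> 0"
      using u by (auto simp: c00_def intro: tendsto_mult_right_zero)
    show "\<forall>\<^sub>F n in sequentially. adapted_norm A \<beta> n (u n) \<le> C * adapted_norm A \<alpha> n (u n)"
      using eventually_ge_at_top[of 1] by eventually_elim (rule assms(2))
  qed (use assms(1) in simp)
  then show "u \<in> c00 A \<beta>" using u by (simp add: c00_def)
qed

lemma adapted_norm_antimono:
  assumes "\<beta> \<in> admissible_exponents A" "\<beta> \<le> \<alpha>"
  shows "adapted_norm A \<alpha> n x \<le> adapted_norm A \<beta> n x"
  unfolding adapted_norm_def[of A \<alpha>]
proof (rule cSUP_least)
  fix m assume "m \<in> {n..}"
  then have "exp (- \<alpha> * (real m - real n)) * norm (evolution A m n x) \<le>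
      exp (- \<beta> * (real m - real n)) * norm (evolution A m n x)"
    using assms(2) by (intro mult_right_mono) (auto intro: mult_right_mono)
  also have "\<dots> \<le> adapted_norm A \<beta> n x"
    using \<open>m \<in> {n..}\<close> by (intro adapted_norm_upper assms) auto
  finally show "exp (- \<alpha> * (real m - real n)) * norm (evolution A m n x) \<le> adapted_norm A \<beta> n x" .
qed auto

text \<open>A gliding hump argument. If no uniform constant exists, there are vectors at ever later
  times whose \<beta>-norm is 1 while their \<alpha>-norms tend to 0. Placed on a sparse set of
  times, they form a sequence in \<open>c00 A \<alpha>\<close> outside
  \<open>c00 A \<beta>\<close>.\<close>

lemma c00_subset_imp_adapted_norm_le:
  assumes \<alpha>: "\<alpha> \<in> admissible_exponents A" and \<beta>: "\<beta> \<in> admissible_exponents A"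
    and sub: "c00 A \<alpha> \<subseteq> c00 A \<beta>"
  shows "\<exists>K\<ge>0. \<forall>n x. adapted_norm A \<beta> n x \<le> K * adapted_norm A \<alpha> n x"
proof (rule ccontr)
  assume contra: "\<not> ?thesis"
  have "\<forall>n. \<exists>M>0. \<forall>x. adapted_norm A \<beta> n x \<le> M * norm x"
    using adapted_norm_le_norm[OF \<beta>] by blast
  then obtain M where M: "\<And>n. M n > 0" "\<And>n x. adapted_norm A \<beta> n x \<le> M n * norm x"
    by metis
  let ?good = "\<lambda>j n x. adapted_norm A \<beta> n x = 1 \<and> adapted_norm A \<alpha> n x \<le> 1 / (real j + 1)"
  have ex: "\<exists>n>N. \<exists>x. ?good j n x" for N j
  proof -
    \<comment> \<open>The summand \<open>real j + 1\<close> makes the \<alpha>-norm small after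
      normalisation; the sum dominates every \<open>M n\<close> with \<open>n \<le> N\<close>, so
      the comparison with constant \<open>K\<close> can fail only after time
      \<open>N\<close>.\<close>
    define K where "K = real j + 1 + (\<Sum>n\<le>N. M n)"
    have sum0: "(\<Sum>n\<le>N. M n) \<ge> 0" using M(1) by (intro sum_nonneg) (auto intro: less_imp_le)
    then have "K \<ge> 0" by (simp add: K_def)
    then obtain n x where nx: "adapted_norm A \<beta> n x > K * adapted_norm A \<alpha> n x"
      using contra by (meson not_le)
    have "n > N"
    proof (rule ccontr)
      assume "\<not> n > N"
      then have "M n \<le> (\<Sum>n\<le>N. M n)"
        using M(1) by (intro member_le_sum) (auto intro: less_imp_le)
      then have "M n \<le> K" by (simp add: K_def)
      have "adapted_norm A \<beta> n x \<le> M n * norm x" by (rule M)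
      also have "\<dots> \<le> K * adapted_norm A \<alpha> n x"
        using \<open>M n \<le> K\<close> \<open>K \<ge> 0\<close> by (intro mult_mono norm_le_adapted_norm[OF \<alpha>]) auto
      finally show False using nx by simp
    qed
    define r where "r = adapted_norm A \<beta> n x"
    have "K * adapted_norm A \<alpha> n x \<ge> 0" using \<open>K \<ge> 0\<close> \<alpha> by simp
    then have "r > 0" using nx by (simp add: r_def)
    have "(real j + 1) * adapted_norm A \<alpha> n x \<le> K * adapted_norm A \<alpha> n x"
      using sum0 \<alpha> by (intro mult_right_mono) (auto simp: K_def)
    then have "(real j + 1) * adapted_norm A \<alpha> n x \<le> r" using nx by (simp add: r_def)
    then have "?good j n ((1 / r) *\<^sub>R x)"
      using \<open>r > 0\<close> by (simp add: adapted_norm_scaleR[OF \<alpha>] adapted_norm_scaleR[OF \<beta>] field_simps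
          flip: r_def)
    then show ?thesis using \<open>n > N\<close> by blast
  qed
  \<comment> \<open>Dependent choice makes the times strictly increasing; keeping them positive
    leaves room for the condition \<open>u 0 = 0\<close>.\<close>
  have "\<exists>p. \<forall>j. (case p j of (n, x) \<Rightarrow> n > 0 \<and> ?good j n x) \<and> fst (p j) < fst (p (Suc j))"
  proof (rule dependent_nat_choice)
    show "\<exists>p. case p of (n, x) \<Rightarrow> n > 0 \<and> ?good 0 n x"
      using ex[of 0 0] by auto
  next
    fix p :: "nat \<times> 'a" and j
    obtain n x where "n > fst p" "?good (Suc j) n x" using ex[of "fst p" "Suc j"] by blast
    then show "\<exists>p'. (case p' of (n, x) \<Rightarrow> n > 0 \<and> ?good (Suc j) n x) \<and> fst p < fst p'"
      by (intro exI[of _ "(n, x)"]) auto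
  qed
  then obtain p where p:
    "\<forall>j. (case p j of (n, x) \<Rightarrow> n > 0 \<and> ?good j n x) \<and> fst (p j) < fst (p (Suc j))" ..
  define s x where "s j = fst (p j)" and "x j = snd (p j)" for j
  have s: "strict_mono s" using p by (simp add: strict_mono_Suc_iff s_def)
  have good: "s j > 0" "?good j (s j) (x j)" for j
    using spec[OF p, of j] by (auto simp: s_def x_def split: prod.splits)
  define u where "u n = (if n \<in> range s then x (inv s n) else 0)" for n
  have us: "u (s j) = x j" for j
    using strict_mono_imp_inj_on[OF s] by (simp add: u_def)
  have "0 \<notin> range s" using good(1) by (metis imageE less_irrefl)
  then have "u 0 = 0" by (simp add: u_def)
  have "(\<lambda>n. adapted_norm A \<alpha> n (u n)) \<longlonglongrightarrow> 0"
  proof (rule LIMSEQ_I)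
    fix e :: real assume "e > 0"
    then obtain J where J: "1 / (real J + 1) < e"
      using reals_Archimedean[of e] by (auto simp: inverse_eq_divide add.commute)
    have "adapted_norm A \<alpha> n (u n) < e" if "n \<ge> s J" for n
    proof (cases "n \<in> range s")
      case True
      then obtain j where j: "n = s j" by blast
      then have "J \<le> j" using that s by (simp add: strict_mono_less_eq)
      then have "1 / (real j + 1) \<le> 1 / (real J + 1)" by (intro divide_left_mono) auto
      then show ?thesis using good(2)[of j] J by (simp add: j us)
    qed (use \<open>e > 0\<close> \<alpha> in \<open>simp add: u_def\<close>)
    then show "\<exists>N. \<forall>n\<ge>N. norm (adapted_norm A \<alpha> n (u n) - 0) < e"
      using \<alpha> by auto
  qed
  then have "u \<in> c00 A \<beta>" using sub \<open>u 0 = 0\<close> by (auto simp: c00_def)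
  then have "(\<lambda>n. adapted_norm A \<beta> n (u n)) \<longlonglongrightarrow> 0" by (simp add: c00_def)
  from LIMSEQ_subseq_LIMSEQ[OF this s] show False
    using good(2) by (simp add: o_def us LIMSEQ_const_iff)
qed

lemma c00_norm_le:
  assumes "\<alpha> \<in> admissible_exponents A" "0 \<le> K" "u \<in> c00 A \<alpha>"
    and "\<And>n x. adapted_norm A \<beta> n x \<le> K * adapted_norm A \<alpha> n x"
  shows "c00_norm A \<beta> u \<le> K * c00_norm A \<alpha> u"
proof (rule c00_norm_least)
  fix n
  show "adapted_norm A \<beta> n (u n) \<le> K * c00_norm A \<alpha> u"
    using assms(4)[of n "u n"] mult_left_mono[OF c00_norm_upper[OF assms(1,3), of n] assms(2)]
    by simp
qed

lemma bounded_linear_operator_on_equivalent_norm: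
  assumes "bounded_linear_operator_on V N S" "0 \<le> C" "0 \<le> D"
    and N: "\<And>u. u \<in> V \<Longrightarrow> 0 \<le> N u"
    and C: "\<And>u. u \<in> V \<Longrightarrow> N' u \<le> C * N u"
    and D: "\<And>u. u \<in> V \<Longrightarrow> N u \<le> D * N' u"
  shows "bounded_linear_operator_on V N' S"
proof -
  obtain K where K: "\<And>u. u \<in> V \<Longrightarrow> N (S u) \<le> K * N u" and SV: "S ` V \<subseteq> V"
    using assms(1) unfolding bounded_linear_operator_on_def by blast
  have "N' (S u) \<le> (C * (\<bar>K\<bar> * D)) * N' u" if "u \<in> V" for u
  proof -
    have "N' (S u) \<le> C * N (S u)" using C SV that by blast
    also have "\<dots> \<le> C * (K * N u)" using K[OF that] assms(2) by (intro mult_left_mono)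
    \<comment> \<open>The constant in the definition of boundedness may be negative, hence the
      absolute value.\<close>
    also have "\<dots> \<le> C * (\<bar>K\<bar> * N u)"
      using N[OF that] assms(2) by (intro mult_left_mono mult_right_mono) auto
    also have "\<dots> \<le> C * (\<bar>K\<bar> * (D * N' u))"
      using D[OF that] assms(2) by (intro mult_left_mono) auto
    finally show ?thesis by (simp add: mult_ac)
  qed
  then show ?thesis using assms(1) unfolding bounded_linear_operator_on_def by blast
qed

section \<open>The operator \<open>G_map\<close> and its inverse for a negative exponent\<close>

lemma G_map_0 [simp]: "G_map A u 0 = - u 0"
  by (simp add: G_map_def evolution_map_def)

lemma G_map_Suc [simp]: "G_map A u (Suc n) = A n (u n) - u (Suc n)"
  by (simp add: G_map_def evolution_map_def)

text \<open>The value at 0 is determined, and each later value follows from its predecessor. Since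
  this concerns arbitrary sequences, it can identify a preimage before its membership in
  \<open>c00\<close> is known.\<close>

lemma G_map_inject:
  assumes "G_map A u = G_map A v" shows "u = v"
proof
  fix n
  show "u n = v n"
  proof (induction n)
    case 0
    then show ?case using fun_cong[OF assms, of 0] by simp
  next
    case (Suc n)
    then show ?case using fun_cong[OF assms, of "Suc n"] by simp
  qed
qed

lemma G_map_bounded:
  assumes \<alpha>: "\<alpha> \<in> admissible_exponents A"
  shows "bounded_linear_operator_on (c00 A \<alpha>) (c00_norm A \<alpha>) (G_map A)"
proof -
  have step: "adapted_norm A \<alpha> (Suc n) (G_map A u (Suc n)) \<le>
      exp \<alpha> * adapted_norm A \<alpha> n (u n) + adapted_norm A \<alpha> (Suc n) (u (Suc n))" for u n
    using adapted_norm_diff[OF \<alpha>, of "Suc n" "A n (u n)" "u (Suc n)"]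
      adapted_norm_step[OF \<alpha>, of n "u n"] by simp
  have "G_map A u \<in> c00 A \<alpha>" if "u \<in> c00 A \<alpha>" for u
  proof -
    have lim: "(\<lambda>n. adapted_norm A \<alpha> n (u n)) \<longlonglongrightarrow> 0" using that by (simp add: c00_def)
    have "(\<lambda>n. adapted_norm A \<alpha> (Suc n) (G_map A u (Suc n))) \<longlonglongrightarrow> 0"
    proof (rule tendsto_sandwich[OF _ _ tendsto_const])
      show "(\<lambda>n. exp \<alpha> * adapted_norm A \<alpha> n (u n) + adapted_norm A \<alpha> (Suc n) (u (Suc n)))
          \<longlonglongrightarrow> 0"
        using lim LIMSEQ_Suc[OF lim] by (intro tendsto_add_zero tendsto_mult_right_zero)
    qed (use step \<alpha> in \<open>auto simp del: G_map_Suc\<close>)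
    then show ?thesis
      using that LIMSEQ_imp_Suc[of "\<lambda>n. adapted_norm A \<alpha> n (G_map A u n)"]
      by (simp add: c00_def)
  qed
  moreover have "c00_norm A \<alpha> (G_map A u) \<le> (exp \<alpha> + 1) * c00_norm A \<alpha> u"
    if u: "u \<in> c00 A \<alpha>" for u
  proof (rule c00_norm_least)
    fix n
    note upper = c00_norm_upper[OF \<alpha> u] and nonneg = c00_norm_nonneg[OF \<alpha> u]
    show "adapted_norm A \<alpha> n (G_map A u n) \<le> (exp \<alpha> + 1) * c00_norm A \<alpha> u"
    proof (cases n)
      case 0
      then show ?thesis using u \<alpha> nonneg by (simp add: c00_def)
    next
      case (Suc k)
      have "exp \<alpha> * adapted_norm A \<alpha> k (u k) \<le> exp \<alpha> * c00_norm A \<alpha> u"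
        using upper by (intro mult_left_mono) auto
      then show ?thesis
        using step[of k u] upper[of "Suc k"] unfolding Suc distrib_right by linarith
    qed
  qed
  ultimately show ?thesis
    unfolding bounded_linear_operator_on_def
    by (intro conjI exI[of _ "exp \<alpha> + 1"])
      (auto simp: G_map_def evolution_map_def fun_eq_iff blinfun.add_right blinfun.scaleR_right
        scaleR_diff_right)
qed

text \<open>Inverts \<open>G_map\<close> on all sequences, so for a given exponent only invariance
  of \<open>c00\<close> and boundedness remain to be shown.\<close>

primrec G_inverse :: "(nat \<Rightarrow> 'a::real_normed_vector \<Rightarrow>\<^sub>L 'a) \<Rightarrow> (nat \<Rightarrow> 'a) \<Rightarrow> nat \<Rightarrow> 'a" where
  "G_inverse A f 0 = - f 0"
| "G_inverse A f (Suc n) = A n (G_inverse A f n) - f (Suc n)"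

lemma G_map_G_inverse: "G_map A (G_inverse A f) = f"
proof
  show "G_map A (G_inverse A f) n = f n" for n by (cases n) auto
qed

lemma G_inverse_G_map: "G_inverse A (G_map A u) = u"
  by (rule G_map_inject) (rule G_map_G_inverse)

lemma perturbed_contraction_tendsto_0:
  fixes a b :: "nat \<Rightarrow> real"
  assumes r: "0 \<le> r" "r < 1" and a: "\<And>n. 0 \<le> a n"
    and rec: "\<And>n. a (Suc n) \<le> r * a n + b n" and b: "b \<longlonglongrightarrow> 0"
  shows "a \<longlonglongrightarrow> 0"
proof (rule LIMSEQ_I)
  fix e :: real assume "e > 0"
  \<comment> \<open>With this threshold \<open>e / 2\<close> is the fixed point of the map sending
    \<open>t\<close> to \<open>r * t + e / 2 * (1 - r)\<close>, so the error does not accumulate in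
    the induction.\<close>
  then have "e / 2 * (1 - r) > 0" using r by simp
  then obtain N where N: "\<And>n. n \<ge> N \<Longrightarrow> b n < e / 2 * (1 - r)"
    using order_tendstoD(2)[OF b] unfolding eventually_sequentially by blast
  have bound: "a (N + j) \<le> r ^ j * a N + e / 2" for j
  proof (induction j)
    case 0
    then show ?case using \<open>e > 0\<close> by simp
  next
    case (Suc j)
    have "a (N + Suc j) \<le> r * a (N + j) + e / 2 * (1 - r)"
      using rec[of "N + j"] N[of "N + j"] by simp
    also have "\<dots> \<le> r * (r ^ j * a N + e / 2) + e / 2 * (1 - r)"
      using mult_left_mono[OF Suc r(1)] by simp
    also have "\<dots> = r ^ Suc j * a N + e / 2" by (simp add: field_simps)
    finally show ?case .
  qed
  have "(\<lambda>j. r ^ j * a N) \<longlonglongrightarrow> 0"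
    using r by (intro tendsto_mult_left_zero LIMSEQ_realpow_zero) auto
  then obtain J where J: "\<And>j. j \<ge> J \<Longrightarrow> r ^ j * a N < e / 2"
    using order_tendstoD(2)[of _ 0 sequentially "e / 2"] \<open>e > 0\<close>
    by (auto simp: eventually_sequentially)
  have "a n < e" if "n \<ge> N + J" for n
  proof -
    have "r ^ (n - N) * a N < e / 2" using that by (intro J) simp
    then show ?thesis using bound[of "n - N"] that by simp
  qed
  then show "\<exists>M. \<forall>n\<ge>M. norm (a n - 0) < e" using a by auto
qed

lemma G_inverse_bounded:
  assumes \<beta>: "\<beta> \<in> admissible_exponents A" and neg: "\<beta> < 0"
  shows "bounded_linear_operator_on (c00 A \<beta>) (c00_norm A \<beta>) (G_inverse A)"
proof -
  define r where "r = exp \<beta>"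
  have r: "0 \<le> r" "r < 1" using neg by (auto simp: r_def)
  have step: "adapted_norm A \<beta> (Suc n) (G_inverse A f (Suc n)) \<le>
      r * adapted_norm A \<beta> n (G_inverse A f n) + adapted_norm A \<beta> (Suc n) (f (Suc n))" for f n
    using adapted_norm_diff[OF \<beta>, of "Suc n" "A n (G_inverse A f n)" "f (Suc n)"]
      adapted_norm_step[OF \<beta>, of n "G_inverse A f n"] by (simp add: r_def)
  have "G_inverse A f \<in> c00 A \<beta>" if f: "f \<in> c00 A \<beta>" for f
  proof -
    have "(\<lambda>n. adapted_norm A \<beta> (Suc n) (f (Suc n))) \<longlonglongrightarrow> 0"
      using f by (intro LIMSEQ_Suc) (simp add: c00_def)
    then have "(\<lambda>n. adapted_norm A \<beta> n (G_inverse A f n)) \<longlonglongrightarrow> 0"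
      using r adapted_norm_nonneg[OF \<beta>] step
      by (intro perturbed_contraction_tendsto_0[where r = r and
            a = "\<lambda>n. adapted_norm A \<beta> n (G_inverse A f n)"])
    then show ?thesis using f by (simp add: c00_def)
  qed
  moreover have "c00_norm A \<beta> (G_inverse A f) \<le> (1 / (1 - r)) * c00_norm A \<beta> f"
    if f: "f \<in> c00 A \<beta>" for f
  proof (rule c00_norm_least)
    fix n
    define F where "F = c00_norm A \<beta> f"
    have F: "0 \<le> F" "\<And>n. adapted_norm A \<beta> n (f n) \<le> F"
      using c00_norm_nonneg[OF \<beta> f] c00_norm_upper[OF \<beta> f] by (auto simp: F_def)
    \<comment> \<open>The constant \<open>1 / (1 - r)\<close> is the sum of the geometric series of
      ratio \<open>r\<close>; clearing the denominator gives an inductive form without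
      division.\<close>
    have "(1 - r) * adapted_norm A \<beta> n (G_inverse A f n) \<le> F"
    proof (induction n)
      case 0
      then show ?case using f \<beta> F by (simp add: c00_def)
    next
      case (Suc n)
      have "(1 - r) * adapted_norm A \<beta> (Suc n) (G_inverse A f (Suc n)) \<le>
          (1 - r) * (r * adapted_norm A \<beta> n (G_inverse A f n) + F)"
        using step[of n f] F(2)[of "Suc n"] r by (intro mult_left_mono) auto
      also have "\<dots> \<le> r * F + (1 - r) * F"
        using mult_left_mono[OF Suc r(1)] by (simp add: algebra_simps)
      finally show ?case by (simp add: algebra_simps)
    qed
    then show "adapted_norm A \<beta> n (G_inverse A f n) \<le> (1 / (1 - r)) * c00_norm A \<beta> f"
      using r by (simp add: F_def field_simps)
  qed
  moreover have "G_inverse A (\<lambda>n. u n + v n) = (\<lambda>n. G_inverse A u n + G_inverse A v n)" for u v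
  proof
    show "G_inverse A (\<lambda>n. u n + v n) n = G_inverse A u n + G_inverse A v n" for n
      by (induction n) (auto simp: blinfun.add_right)
  qed
  moreover have "G_inverse A (\<lambda>n. c *\<^sub>R u n) = (\<lambda>n. c *\<^sub>R G_inverse A u n)" for c u
  proof
    show "G_inverse A (\<lambda>n. c *\<^sub>R u n) n = c *\<^sub>R G_inverse A u n" for n
      by (induction n) (auto simp: blinfun.scaleR_right scaleR_diff_right)
  qed
  ultimately show ?thesis unfolding bounded_linear_operator_on_def by blast
qed

text \<open>The two inclusions between the spaces yield comparison constants in both directions,
  which carry the bound on \<open>G_inverse\<close> from the \<beta>-norm to the
  \<alpha>-norm.\<close>

lemma invertible_if_negative_exponent:
  assumes \<alpha>: "\<alpha> \<in> admissible_exponents A" and \<beta>: "\<beta> \<in> admissible_exponents A"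
    and neg: "\<beta> < 0" and eq: "c00 A \<alpha> = c00 A \<beta>"
  shows "invertible_operator_on (c00 A \<alpha>) (c00_norm A \<alpha>) (G_map A)"
proof -
  obtain C where C: "C \<ge> 0" "\<And>n x. adapted_norm A \<alpha> n x \<le> C * adapted_norm A \<beta> n x"
    using c00_subset_imp_adapted_norm_le[OF \<beta> \<alpha>] eq by blast
  obtain D where D: "D \<ge> 0" "\<And>n x. adapted_norm A \<beta> n x \<le> D * adapted_norm A \<alpha> n x"
    using c00_subset_imp_adapted_norm_le[OF \<alpha> \<beta>] eq by blast
  have "bounded_linear_operator_on (c00 A \<beta>) (c00_norm A \<alpha>) (G_inverse A)"
    using G_inverse_bounded[OF \<beta> neg] C(1) D(1)
  proof (rule bounded_linear_operator_on_equivalent_norm)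
    fix u assume "u \<in> c00 A \<beta>"
    then show "0 \<le> c00_norm A \<beta> u" "c00_norm A \<alpha> u \<le> C * c00_norm A \<beta> u"
      "c00_norm A \<beta> u \<le> D * c00_norm A \<alpha> u"
      using c00_norm_nonneg[OF \<beta>] c00_norm_le[OF \<beta> C(1) _ C(2)] c00_norm_le[OF \<alpha> D(1) _ D(2)] eq
      by auto
  qed
  then show ?thesis
    using G_map_bounded[OF \<alpha>] eq
    by (auto simp: invertible_operator_on_def G_map_G_inverse G_inverse_G_map)
qed

section \<open>From an inverse of \<open>G_map\<close> to exponential decay and a negative
  exponent\<close>

text \<open>The start \<open>k\<close> is at least 1 because the test sequence takes the value
  \<open>x\<close> at time \<open>k\<close>, while members of \<open>c00\<close> vanish at time
  0.\<close>

lemma invertible_imp_exponential_decay: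
  assumes \<alpha>: "\<alpha> \<in> admissible_exponents A"
    and inv: "invertible_operator_on (c00 A \<alpha>) (c00_norm A \<alpha>) (G_map A)"
  shows "\<exists>q>1. \<exists>C>0. \<forall>k\<ge>1. \<forall>m\<ge>k. \<forall>x.
    q ^ (m - k) * adapted_norm A \<alpha> m (evolution A m k x) \<le> C * adapted_norm A \<alpha> k x"
proof -
  obtain S where S: "bounded_linear_operator_on (c00 A \<alpha>) (c00_norm A \<alpha>) S"
    and GS: "\<And>u. u \<in> c00 A \<alpha> \<Longrightarrow> G_map A (S u) = u"
    using inv unfolding invertible_operator_on_def by blast
  have SV: "S u \<in> c00 A \<alpha>" if "u \<in> c00 A \<alpha>" for u
    using S that unfolding bounded_linear_operator_on_def image_subset_iff by (elim conjE bspec)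
  have "\<exists>K0. \<forall>u\<in>c00 A \<alpha>. c00_norm A \<alpha> (S u) \<le> K0 * c00_norm A \<alpha> u"
    using S unfolding bounded_linear_operator_on_def by (elim conjE)
  then obtain K0 where
    K0: "\<And>u. u \<in> c00 A \<alpha> \<Longrightarrow> c00_norm A \<alpha> (S u) \<le> K0 * c00_norm A \<alpha> u" by blast
  define K where "K = max K0 1"
  have "K > 0" by (simp add: K_def)
  have K: "c00_norm A \<alpha> (S u) \<le> K * c00_norm A \<alpha> u" if "u \<in> c00 A \<alpha>" for u
    using K0[OF that] mult_right_mono[of K0 K "c00_norm A \<alpha> u"] c00_norm_nonneg[OF \<alpha> that]
    by (simp add: K_def)
  define q where "q = 1 + 1 / (2 * K)"
  have q: "q > 1" using \<open>K > 0\<close> by (simp add: q_def)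
  \<comment> \<open>Here \<open>1 - 1 / q\<close> equals \<open>1 / (2 * K + 1)\<close>.\<close>
  have Kq: "K * (1 - 1 / q) \<le> 1 / 2" using \<open>K > 0\<close> by (simp add: q_def field_simps)
  have "q ^ (m - k) * adapted_norm A \<alpha> m (evolution A m k x) \<le> 2 * K * adapted_norm A \<alpha> k x"
    if k: "1 \<le> k" and m: "k \<le> m" for k m x
  proof -
    \<comment> \<open>The minimum freezes the factor after time \<open>m\<close>: from there on
      \<open>u\<close> follows the evolution exactly, so \<open>G_map A u\<close> has finite support
      although \<open>u\<close> itself need not.\<close>
    define u where "u n = (if k \<le> n then q ^ (min n m - k) *\<^sub>R evolution A n k x else 0)" for n
    define f where "f = G_map A u"
    have f: "f n = (if n = k then - x else if k < n \<and> n \<le> m then - ((1 - 1 / q) *\<^sub>R u n) else 0)"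
      for n
    proof (cases n)
      case 0
      then show ?thesis using k by (simp add: f_def u_def)
    next
      case (Suc j)
      consider "n < k" | "n = k" | "k < n" "n \<le> m" | "k < n" "n > m" by linarith
      then show ?thesis
      proof cases
        case 1
        then show ?thesis using Suc by (simp add: f_def u_def blinfun.zero_right)
      next
        case 2
        then show ?thesis using Suc by (auto simp: f_def u_def blinfun.zero_right)
      next
        case 3
        then have "min n m - k = Suc (min j m - k)" using Suc by simp
        then have "u n = q *\<^sub>R A j (u j)"
          using 3 Suc by (simp add: u_def evolution_Suc_apply blinfun.scaleR_right)
        then have "A j (u j) = (1 / q) *\<^sub>R u n" using q by simp
        then show ?thesis using 3 Suc by (simp add: f_def scaleR_diff_left)
      next
        case 4
        then have "min n m = min j m" using Suc by simp
        then show ?thesis using 4 Suc m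
          by (simp add: f_def u_def evolution_Suc_apply blinfun.scaleR_right)
      qed
    qed
    have fin: "f \<in> c00 A \<alpha>"
      using k m by (intro finite_support_in_c00[OF \<alpha>, of _ m]) (auto simp: f)
    \<comment> \<open>Membership of \<open>u\<close> in \<open>c00 A \<alpha>\<close> is not clear
      directly; it follows because \<open>S f\<close> lies there and has the same image under
      \<open>G_map\<close>.\<close>
    then have "S f = u" using GS G_map_inject by (metis f_def)
    then have u: "u \<in> c00 A \<alpha>" and le: "c00_norm A \<alpha> u \<le> K * c00_norm A \<alpha> f"
      using SV[OF fin] K[OF fin] by auto
    have U0: "c00_norm A \<alpha> u \<ge> 0" by (rule c00_norm_nonneg[OF \<alpha> u])
    have q1: "0 \<le> 1 - 1 / q" using q by simp
    have "c00_norm A \<alpha> f \<le> adapted_norm A \<alpha> k x + (1 - 1 / q) * c00_norm A \<alpha> u"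
    proof (rule c00_norm_least)
      fix n
      have "adapted_norm A \<alpha> n (f n) \<le> (1 - 1 / q) * adapted_norm A \<alpha> n (u n)" if "n \<noteq> k"
        using that q1 \<alpha> by (simp add: f adapted_norm_scaleR[OF \<alpha>])
      moreover have "(1 - 1 / q) * adapted_norm A \<alpha> n (u n) \<le> (1 - 1 / q) * c00_norm A \<alpha> u"
        using q1 by (intro mult_left_mono c00_norm_upper[OF \<alpha> u])
      moreover have "0 \<le> (1 - 1 / q) * c00_norm A \<alpha> u" using q1 U0 by (rule mult_nonneg_nonneg)
      ultimately show "adapted_norm A \<alpha> n (f n) \<le>
          adapted_norm A \<alpha> k x + (1 - 1 / q) * c00_norm A \<alpha> u"
        using adapted_norm_nonneg[OF \<alpha>, of k x] \<alpha> by (cases "n = k") (simp add: f, linarith)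
    qed
    then have "K * c00_norm A \<alpha> f \<le>
        K * (adapted_norm A \<alpha> k x + (1 - 1 / q) * c00_norm A \<alpha> u)"
      using \<open>K > 0\<close> by (intro mult_left_mono) auto
    with le have "c00_norm A \<alpha> u \<le>
        K * adapted_norm A \<alpha> k x + K * (1 - 1 / q) * c00_norm A \<alpha> u"
      unfolding distrib_left mult.assoc by linarith
    also have "\<dots> \<le> K * adapted_norm A \<alpha> k x + 1 / 2 * c00_norm A \<alpha> u"
      using mult_right_mono[OF Kq U0] by simp
    finally have "c00_norm A \<alpha> u \<le> 2 * K * adapted_norm A \<alpha> k x" by simp
    moreover have "adapted_norm A \<alpha> m (u m) = q ^ (m - k) * adapted_norm A \<alpha> m (evolution A m k x)"
      using m q by (simp add: u_def adapted_norm_scaleR[OF \<alpha>])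
    ultimately show ?thesis using c00_norm_upper[OF \<alpha> u, of m] by simp
  qed
  then show ?thesis using q \<open>K > 0\<close> by (intro exI[of _ q] conjI exI[of _ "2 * K"]) auto
qed

text \<open>The decay factor \<open>q\<close> makes \<open>- ln q\<close> an admissible exponent,
  and the same estimate bounds the new adapted norms by the old ones from time 1 on.\<close>

lemma negative_exponent_if_invertible:
  assumes \<alpha>: "\<alpha> \<in> admissible_exponents A"
    and inv: "invertible_operator_on (c00 A \<alpha>) (c00_norm A \<alpha>) (G_map A)"
  shows "\<exists>\<beta><0. \<beta> \<in> admissible_exponents A \<and> c00 A \<alpha> = c00 A \<beta>"
proof (cases "\<alpha> < 0")
  \<comment> \<open>The case \<alpha> < 0 is settled at the end with \<beta> = \<alpha>. Here
    \<alpha> is nonnegative, so a negative \<beta> lies below it.\<close>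
  case False
  obtain q C where q: "q > 1" and C: "C > 0" and decay: "\<And>k m x. 1 \<le> k \<Longrightarrow> k \<le> m \<Longrightarrow>
      q ^ (m - k) * adapted_norm A \<alpha> m (evolution A m k x) \<le> C * adapted_norm A \<alpha> k x"
    using invertible_imp_exponential_decay[OF \<alpha> inv] by blast
  define \<beta> where "\<beta> = - ln q"
  have neg: "\<beta> < 0" using q by (simp add: \<beta>_def)
  have weight: "exp (- \<beta> * (real m - real n)) = q ^ (m - n)" if "n \<le> m" for m n
    using q that by (simp add: \<beta>_def exp_of_nat2_mult flip: of_nat_diff)
  have decay_norm: "exp (- \<beta> * (real m - real k)) * norm (evolution A m k x) \<le>
      C * adapted_norm A \<alpha> k x" if "1 \<le> k" "k \<le> m" for k m x
  proof -
    have "q ^ (m - k) * norm (evolution A m k x) \<le>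
        q ^ (m - k) * adapted_norm A \<alpha> m (evolution A m k x)"
      using q by (intro mult_left_mono norm_le_adapted_norm[OF \<alpha>]) auto
    then show ?thesis using decay[OF that, of x] weight[OF that(2)] by simp
  qed
  text \<open>The decay estimate starts at time 1, so time 0 is reached through \<open>A 0\<close>.\<close>
  have "\<exists>M>0. \<forall>m\<ge>k. norm (evolution A m k) \<le> M * exp (\<beta> * (real m - real k))" for k
  proof -
    have unweight: "norm (evolution A m k) \<le> M * exp (\<beta> * (real m - real k))"
      if "M > 0"
        "\<And>x. exp (- \<beta> * (real m - real k)) * norm (evolution A m k x) \<le> M * norm x" for M m
    proof (rule norm_blinfun_bound)
      fix x
      define d where "d = real m - real k"
      show "norm (evolution A m k x) \<le> M * exp (\<beta> * (real m - real k)) * norm x"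
        using that(2)[of x] unfolding d_def[symmetric] by (simp add: exp_minus field_simps)
    qed (use \<open>M > 0\<close> in simp)
    show ?thesis
    proof (cases k)
      case (Suc j)
      obtain M where M: "M > 0" "\<And>x. adapted_norm A \<alpha> k x \<le> M * norm x"
        using adapted_norm_le_norm[OF \<alpha>] by blast
      have "exp (- \<beta> * (real m - real k)) * norm (evolution A m k x) \<le> (C * M) * norm x"
        if "k \<le> m" for m x
      proof -
        have "exp (- \<beta> * (real m - real k)) * norm (evolution A m k x) \<le>
            C * adapted_norm A \<alpha> k x"
          using that Suc by (intro decay_norm) auto
        also have "\<dots> \<le> C * (M * norm x)" using M(2) C by (intro mult_left_mono) auto
        finally show ?thesis by (simp add: mult.assoc)
      qed
      then show ?thesis using C M(1) unweight by (intro exI[of _ "C * M"]) auto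
    next
      case 0
      obtain M where M: "M > 0" "\<And>x. adapted_norm A \<alpha> 1 x \<le> M * norm x"
        using adapted_norm_le_norm[OF \<alpha>] by blast
      \<comment> \<open>The 1 covers \<open>m = 0\<close>; the other term passes through
        \<open>A 0\<close> and then uses decay from time 1, its factor \<open>q\<close> paying for
        the step from 0 to 1.\<close>
      define L where "L = 1 + q * (C * (M * norm (A 0)))"
      have "0 \<le> q * (C * (M * norm (A 0)))" using q C M(1) by simp
      then have "L > 0" by (simp add: L_def)
      have "exp (- \<beta> * (real m - real k)) * norm (evolution A m k x) \<le> L * norm x" for m x
      proof (cases m)
        case 0
        have "1 \<le> L" using \<open>0 \<le> q * _\<close> by (simp add: L_def)
        then show ?thesis using \<open>k = 0\<close> 0 mult_right_mono[of 1 L "norm x"] by simp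
      next
        case (Suc j)
        have ev: "evolution A m k x = evolution A m 1 (A 0 x)"
          using evolution_compose[of 0 1 m A x] Suc \<open>k = 0\<close>
          by (simp add: evolution_Suc_apply)
        have "q ^ (m - 1) * norm (evolution A m 1 (A 0 x)) \<le> C * adapted_norm A \<alpha> 1 (A 0 x)"
          using decay_norm[of 1 m "A 0 x"] weight[of 1 m] Suc by simp
        also have "\<dots> \<le> C * (M * (norm (A 0) * norm x))"
          using C M by (intro mult_left_mono order_trans[OF M(2)] norm_blinfun) auto
        finally have "q * (q ^ (m - 1) * norm (evolution A m 1 (A 0 x))) \<le>
            q * (C * (M * (norm (A 0) * norm x)))"
          using q by (intro mult_left_mono) auto
        also have "\<dots> \<le> L * norm x" by (simp add: L_def algebra_simps)
        finally show ?thesis using weight[of k m] ev Suc \<open>k = 0\<close> by simp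
      qed
      then show ?thesis using \<open>L > 0\<close> unweight by (intro exI[of _ L]) auto
    qed
  qed
  then have \<beta>: "\<beta> \<in> admissible_exponents A"
    unfolding admissible_exponents_def mem_Collect_eq by metis
  \<comment> \<open>The bound in \<open>decay_norm\<close> does not depend on the end time, so it
    passes to the supremum defining the \<beta>-norm. The other inclusion only needs that a larger
    exponent gives smaller weights.\<close>
  have "c00 A \<alpha> \<subseteq> c00 A \<beta>"
    using \<beta> adapted_norm_least[OF \<beta> decay_norm] by (rule c00_mono)
  moreover have "c00 A \<beta> \<subseteq> c00 A \<alpha>"
    using adapted_norm_antimono[OF \<beta>, of \<alpha>] neg False
    by (intro c00_mono[OF \<alpha>, of 1]) auto
  ultimately show ?thesis using neg \<beta> by auto
qed (use \<alpha> in blast)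

theorem theorem3p3:
  fixes A :: "nat \<Rightarrow> 'a::banach \<Rightarrow>\<^sub>L 'a" and \<alpha> :: real
  assumes "\<alpha> \<in> admissible_exponents A"
  shows "invertible_operator_on (c00 A \<alpha>) (c00_norm A \<alpha>) (G_map A) \<longleftrightarrow>
         (\<exists>\<beta>::real. \<beta> < 0 \<and> \<beta> \<in> admissible_exponents A \<and> c00 A \<alpha> = c00 A \<beta>)"
  using invertible_if_negative_exponent[OF assms] negative_exponent_if_invertible[OF assms] by blast

end
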